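(* Let $X$ be a finite dimensional Euclidean space with its distance $d$, let $\mu$ be a Borel probability measure on $X$ and let $f\colon X\to X$ be a measurable map preserving $\mu$. Assume that the local decay of correlations of $(X,f,\mu)$ is super-polynomial. Then for $\mu$-a.e. $x$ in the set $\{x\in X:\underline{R}(x)>0\}$, $$\underline{R}(x)=\underline{d}_\mu(x)\quad\text{and}\quad\overline{R}(x)=\overline{d}_\mu(x).$$
   Context: Return time and recurrence rates: for $x\in X$ and $r>0$, $\tau_r(x)=\inf\{n\ge 1: d(f^n x,x)<r\}$, and $$\underline{R}(x)=\liminf_{r\to0}\frac{\log\tau_r(x)}{\log(1/r)},\qquad \overline{R}(x)=\limsup_{r\to0}\frac{\log\tau_r(x)}{\log(1/r)}.$$ Pointwise dimensions: with $B(x,r)$ the ball of center $x$ and radius $r$, $$\underline{d}_\mu(x)=\liminf_{r\to0}\frac{\log\mu(B(x,r))}{\log r},\qquad \overline{d}_\mu(x)=\limsup_{r\to0}\frac{\log\mu(B(x,r))}{\log r}.$$ Local decay of correlations: let $\|\cdot\|$ be the Lipschitz norm on real (bounded) Lipschitz functions on $X$, i.e. sup norm plus best Lipschitz constant. The local decay of correlations is super-polynomial if there exist a partition (modulo $\mu$) of $X$ into open sets $V_i$ (pairwise disjoint open sets whose union has full $\mu$-measure) and sequences $(\theta^i_n)_n$, with $\lim_{n\to\infty} n^p\theta^i_n=0$ for all $p>0$ and each $i$, such that for every $i$, all $n$ and all Lipschitz $\varphi,\psi$ with $\operatorname{supp}\varphi\subset V_i$ and $\operatorname{supp}\psi\subset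 V_i$, $$\left|\int \varphi\circ f^n\,\psi\, d\mu-\int\varphi\, d\mu\int\psi\, d\mu\right|\le \|\varphi\|\,\|\psi\|\,\theta_n^i.$$ *)

theory Defs
  imports "HOL-Probability.Probability"
begin

(* The return time is \<infinity> for points that do not come back to the ball; likewise a ball may have
   measure zero. The logarithm is therefore extended by ln 0 = -\<infinity> and ln \<infinity> = \<infinity>, and the rates
   below take values in the extended reals. The value at negative arguments is never used. *)
definition ln_ext :: "ereal \<Rightarrow> ereal" where
  "ln_ext t = (if t = \<infinity> then \<infinity> else if t \<le> 0 then - \<infinity> else ereal (ln (real_of_ereal t)))"

definition return_time :: "('a::metric_space \<Rightarrow> 'a) \<Rightarrow> real \<Rightarrow> 'a \<Rightarrow> enat" where
  "return_time f r x = (INF n\<in>{n. 1 \<le> n \<and> dist ((f ^^ n) x) x < r}. enat n)"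

definition lower_recurrence_rate :: "('a::metric_space \<Rightarrow> 'a) \<Rightarrow> 'a \<Rightarrow> ereal" where
  "lower_recurrence_rate f x =
     Liminf (at_right 0) (\<lambda>r. ln_ext (ereal_of_enat (return_time f r x)) / ereal (ln (1 / r)))"

definition upper_recurrence_rate :: "('a::metric_space \<Rightarrow> 'a) \<Rightarrow> 'a \<Rightarrow> ereal" where
  "upper_recurrence_rate f x =
     Limsup (at_right 0) (\<lambda>r. ln_ext (ereal_of_enat (return_time f r x)) / ereal (ln (1 / r)))"

definition lower_pointwise_dim :: "'a::metric_space measure \<Rightarrow> 'a \<Rightarrow> ereal" where
  "lower_pointwise_dim M x =
     Liminf (at_right 0) (\<lambda>r. ln_ext (enn2ereal (emeasure M (ball x r))) / ereal (ln r))"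

definition upper_pointwise_dim :: "'a::metric_space measure \<Rightarrow> 'a \<Rightarrow> ereal" where
  "upper_pointwise_dim M x =
     Limsup (at_right 0) (\<lambda>r. ln_ext (enn2ereal (emeasure M (ball x r))) / ereal (ln r))"

definition bounded_lipschitz :: "('a::metric_space \<Rightarrow> real) \<Rightarrow> bool" where
  "bounded_lipschitz \<phi> \<longleftrightarrow> bounded (range \<phi>) \<and> (\<exists>C. C-lipschitz_on UNIV \<phi>)"

(* Only meaningful when bounded_lipschitz \<phi> holds. *)
definition lipschitz_norm :: "('a::metric_space \<Rightarrow> real) \<Rightarrow> real" where
  "lipschitz_norm \<phi> = (SUP x. \<bar>\<phi> x\<bar>) + Inf {C. C-lipschitz_on UNIV \<phi>}"

definition closed_support :: "('a::topological_space \<Rightarrow> real) \<Rightarrow> 'a set" where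
  "closed_support \<phi> = closure {x. \<phi> x \<noteq> 0}"

(* The partition is given as the set \<V> of its pieces, which also serves as the index set of the
   sequences \<theta>. *)
definition superpolynomial_local_decay :: "'a::metric_space measure \<Rightarrow> ('a \<Rightarrow> 'a) \<Rightarrow> bool" where
  "superpolynomial_local_decay M f \<longleftrightarrow>
     (\<exists>(\<V> :: 'a set set) (\<theta> :: 'a set \<Rightarrow> nat \<Rightarrow> real).
        (\<forall>V\<in>\<V>. open V) \<and> disjoint \<V> \<and> (AE x in M. x \<in> \<Union>\<V>) \<and>
        (\<forall>V\<in>\<V>. \<forall>p>0. (\<lambda>n. real n powr p * \<theta> V n) \<longlonglongrightarrow> 0) \<and>
        (\<forall>V\<in>\<V>. \<forall>n \<phi> \<psi>.
           bounded_lipschitz \<phi> \<and> bounded_lipschitz \<psi> \<and>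
           closed_support \<phi> \<subseteq> V \<and> closed_support \<psi> \<subseteq> V \<longrightarrow>
           \<bar>(\<integral>x. \<phi> ((f ^^ n) x) * \<psi> x \<partial>M) - (\<integral>x. \<phi> x \<partial>M) * (\<integral>x. \<psi> x \<partial>M)\<bar>
             \<le> lipschitz_norm \<phi> * lipschitz_norm \<psi> * \<theta> V n))"

end

theory Submission
  imports Defs
begin

text \<open>
  Write \<open>r = 2\<^sup>-\<^sup>n\<close>, and call a return time \<open>k\<close> of \<open>x\<close> to its own \<open>r\<close>-ball an \<open>r\<close>-return.
  The theorem says that at almost every point of positive lower recurrence rate the first
  \<open>r\<close>-return happens, on the exponential scale, at time \<open>1 / \<mu> (B x r)\<close>.
  Both halves are proved one scale at a time by bounding the measure of an exceptional set, and
  Borel--Cantelli along the dyadic radii then gives the statement almost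
  everywhere. The space is covered by balls of radius \<open>r\<close> centred at a lattice, so that
  the enlarged balls overlap at most \<open>K\<close> times with \<open>K\<close> independent of \<open>r\<close>, and so that a bounded
  region needs only polynomially many of them (\<open>bounded_multiplicity_cover\<close>).

  The first return is not too late: for every \<open>Q\<close> the points of \<open>Q\<close> that stay outside \<open>Q\<close> up to time
  \<open>k\<close> have measure at most \<open>1 / (k + 1)\<close>, a form of Kac's lemma. If \<open>m\<close> is the measure of the
  enlarged ball and the waiting time is \<open>r\<^sup>-\<^sup>\<epsilon> / m\<close>, then the exceptional set in one ball has
  measure at most \<open>r\<^sup>\<epsilon> m\<close>, and by bounded overlap these sum to at most \<open>K r\<^sup>\<epsilon>\<close>
  (\<open>quick_return_one_scale\<close>). Because the measure of the enlarged ball enters the waiting time,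
  no doubling property of \<open>\<mu>\<close> is needed.

  The first return is not too early: if the lower recurrence rate at \<open>x\<close> exceeds \<open>a > 0\<close>, only
  returns at times \<open>k \<ge> r powr -a\<close> matter. For such \<open>k\<close> the decay of correlations, applied to a
  Lipschitz bump function on a ball of the cover, bounds the measure of the points of the ball
  that are back at time \<open>k\<close> by \<open>m\<^sup>2\<close> plus an error \<open>r\<^sup>-\<^sup>2 \<theta> k\<close> (up to a constant factor). As
  \<open>\<theta>\<close> decays faster than any power and \<open>k\<close> is at least a power of \<open>1 / r\<close>, the errors are
  negligible even after summation over the polynomially many balls; the terms \<open>m\<^sup>2\<close>, summed over
  \<open>k \<le> r\<^sup>\<epsilon> / m\<close> and over the balls, contribute at most \<open>K r\<^sup>\<epsilon>\<close> (\<open>slow_return_one_scale\<close>).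

  Both conclusions compare the logarithms of the return time and of the measure of a ball up to
  \<open>\<epsilon> ln (1 / r)\<close> and a change of \<open>r\<close> by a constant factor. Neither affects the lower and upper
  limits (\<open>log_ratio_le\<close>).
\<close>

section \<open>Covers of bounded multiplicity\<close>

lemma card_integer_points_cball:
  fixes x :: "'a::euclidean_space"
  assumes "0 \<le> T"
  defines "A \<equiv> {z \<in> cball x T. \<forall>b\<in>Basis. z \<bullet> b \<in> \<int>}"
  shows "finite A" and "real (card A) \<le> (2 * T + 1) ^ DIM('a)"
proof -
  define \<beta> where "\<beta> z = restrict (\<lambda>b. \<lfloor>z \<bullet> b\<rfloor>) Basis" for z :: 'a
  define J where "J b = {\<lceil>x \<bullet> b - T\<rceil>..\<lfloor>x \<bullet> b + T\<rfloor>}" for b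
  have inj: "inj_on \<beta> A"
  proof (rule inj_onI)
    fix y z assume "y \<in> A" "z \<in> A" and eq: "\<beta> y = \<beta> z"
    show "y = z"
    proof (rule euclidean_eqI)
      fix b :: 'a assume b: "b \<in> Basis"
      then have "\<lfloor>y \<bullet> b\<rfloor> = \<lfloor>z \<bullet> b\<rfloor>"
        using fun_cong[OF eq, of b] by (simp add: \<beta>_def)
      moreover have "y \<bullet> b \<in> \<int>" "z \<bullet> b \<in> \<int>"
        using b \<open>y \<in> A\<close> \<open>z \<in> A\<close> by (auto simp: A_def)
      ultimately show "y \<bullet> b = z \<bullet> b"
        by (metis floor_of_int Ints_cases)
    qed
  qed
  have sub: "\<beta> ` A \<subseteq> PiE Basis J"
  proof
    fix w assume "w \<in> \<beta> ` A"
    then obtain z where z: "z \<in> A" "w = \<beta> z" by auto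
    have "\<lfloor>z \<bullet> b\<rfloor> \<in> J b" if b: "b \<in> Basis" for b
    proof -
      have "\<bar>(z - x) \<bullet> b\<bar> \<le> T"
        using Basis_le_norm[OF b, of "z - x"] z
        by (auto simp: A_def dist_norm norm_minus_commute)
      moreover obtain m :: int where m: "z \<bullet> b = of_int m"
        using z b by (auto simp: A_def elim: Ints_cases)
      ultimately show ?thesis
        by (auto simp: J_def inner_diff_left ceiling_le_iff le_floor_iff)
    qed
    then show "w \<in> PiE Basis J"
      using z by (auto simp: \<beta>_def)
  qed
  have fin: "finite (PiE Basis J)"
    by (intro finite_PiE) (auto simp: J_def)
  show "finite A"
    using finite_subset[OF sub fin] inj by (rule finite_imageD)
  have "card A \<le> card (PiE Basis J)"
    by (rule card_inj_on_le[OF inj sub fin])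
  then have "real (card A) \<le> real (card (PiE Basis J))" by simp
  also have "\<dots> = (\<Prod>b\<in>(Basis::'a set). real (card (J b)))"
    by (simp add: card_PiE)
  also have "\<dots> \<le> (\<Prod>b\<in>(Basis::'a set). 2 * T + 1)"
  proof (rule prod_mono)
    fix b :: 'a
    have "real (card (J b)) = real_of_int (max 0 (\<lfloor>x \<bullet> b + T\<rfloor> - \<lceil>x \<bullet> b - T\<rceil> + 1))"
      by (auto simp: J_def)
    also have "\<dots> \<le> 2 * T + 1"
      using assms(1) by (auto simp: max_def) linarith
    finally show "0 \<le> real (card (J b)) \<and> real (card (J b)) \<le> 2 * T + 1" by simp
  qed
  finally show "real (card A) \<le> (2 * T + 1) ^ DIM('a)" by simp
qed

text \<open>
  The balls of radius \<open>r\<close> with centres in the finite set \<open>G\<close> cover the ball of radius \<open>R\<close> about the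
  origin, and no point lies in more than \<open>K\<close> of the balls of radius \<open>4 * r\<close>.
\<close>
definition ball_cover :: "real \<Rightarrow> real \<Rightarrow> real \<Rightarrow> 'a::euclidean_space set \<Rightarrow> bool" where
  "ball_cover R r K G \<longleftrightarrow> finite G \<and> ball 0 R \<subseteq> (\<Union>z\<in>G. ball z r) \<and>
     (\<forall>x. real (card {z\<in>G. dist z x < 4 * r}) \<le> K)"

text \<open>
  The centres are the points near the ball of a lattice of mesh \<open>r / D\<close> in dimension \<open>D\<close>. The
  multiplicity \<open>K\<close> depends neither on the radius \<open>r\<close> nor on \<open>R\<close>.
\<close>
lemma bounded_multiplicity_cover:
  "\<exists>K. \<forall>R>0. \<exists>C\<ge>0. \<forall>r. 0 < r \<and> r \<le> 1 \<longrightarrow>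
     (\<exists>G::'a::euclidean_space set. ball_cover R r K G \<and> real (card G) \<le> C * (1 / r) ^ DIM('a))"
proof -
  define D where "D = real DIM('a)"
  have D: "D \<ge> 1" by (simp add: D_def Suc_leI)
  define K where "K = (2 * (4 * D) + 1) ^ DIM('a)"
  have cov: "\<exists>C\<ge>0. \<forall>r. 0 < r \<and> r \<le> 1 \<longrightarrow>
      (\<exists>G::'a set. ball_cover R r K G \<and> real (card G) \<le> C * (1 / r) ^ DIM('a))"
    if R: "0 < R" for R
    unfolding ball_cover_def
  proof (intro exI conjI allI impI)
    show "0 \<le> (2 * D * (R + 1) + 1) ^ DIM('a)" using R D by simp
    fix r :: real assume "0 < r \<and> r \<le> 1"
    then have r: "0 < r" "r \<le> 1" by auto
    define c where "c = D / r"
    have c: "c > 0" using r D by (simp add: c_def)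
    define A where "A = {l \<in> cball (0::'a) (c * (R + 1)). \<forall>b\<in>Basis. l \<bullet> b \<in> \<int>}"
    define G where "G = (\<lambda>l. (1 / c) *\<^sub>R l) ` A"
    have TA: "0 \<le> c * (R + 1)" using c R by simp
    have "finite A" unfolding A_def by (rule card_integer_points_cball(1)[OF TA])
    then show "finite G" by (simp add: G_def)
    have "real (card G) \<le> real (card A)"
      unfolding G_def using card_image_le[OF \<open>finite A\<close>] by simp
    also have "\<dots> \<le> (2 * (c * (R + 1)) + 1) ^ DIM('a)"
      unfolding A_def by (rule card_integer_points_cball(2)[OF TA])
    also have "\<dots> \<le> ((2 * D * (R + 1) + 1) * (1 / r)) ^ DIM('a)"
      using r D R c by (intro power_mono) (auto simp: c_def field_simps)
    finally show "real (card G) \<le> (2 * D * (R + 1) + 1) ^ DIM('a) * (1 / r) ^ DIM('a)"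
      by (simp only: power_mult_distrib)
    show "ball 0 R \<subseteq> (\<Union>z\<in>G. ball z r)"
    proof
      fix x :: 'a assume x: "x \<in> ball 0 R"
      define l where "l = (\<Sum>b\<in>Basis. of_int \<lfloor>c * (x \<bullet> b)\<rfloor> *\<^sub>R b)"
      have lb: "l \<bullet> b = of_int \<lfloor>c * (x \<bullet> b)\<rfloor>" if "b \<in> Basis" for b
        unfolding l_def using that by simp
      have "norm (c *\<^sub>R x - l) \<le> (\<Sum>b\<in>Basis. \<bar>(c *\<^sub>R x - l) \<bullet> b\<bar>)"
        by (rule norm_le_l1)
      also have "\<dots> < (\<Sum>b\<in>(Basis::'a set). 1)"
      proof (rule sum_strict_mono)
        fix b :: 'a assume "b \<in> Basis"
        then show "\<bar>(c *\<^sub>R x - l) \<bullet> b\<bar> < 1"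
          by (simp add: inner_diff_left lb) linarith
      qed auto
      finally have near: "norm (c *\<^sub>R x - l) < D" by (simp add: D_def)
      have "norm l \<le> norm (c *\<^sub>R x) + norm (c *\<^sub>R x - l)"
        by (metis norm_minus_commute norm_triangle_sub)
      also have "\<dots> \<le> c * R + c * 1"
      proof (rule add_mono)
        show "norm (c *\<^sub>R x) \<le> c * R" using x c by simp
        have "D \<le> c * 1" using r D by (simp add: c_def field_simps)
        then show "norm (c *\<^sub>R x - l) \<le> c * 1" using near by linarith
      qed
      finally have "l \<in> A"
        using lb by (auto simp: A_def algebra_simps)
      have "x - (1 / c) *\<^sub>R l = (1 / c) *\<^sub>R (c *\<^sub>R x - l)"
        using c by (simp add: scaleR_diff_right)
      then have "norm (x - (1 / c) *\<^sub>R l) = norm (c *\<^sub>R x - l) / c"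
        using c by simp
      also have "\<dots> < D / c" using near c by (simp add: divide_strict_right_mono)
      also have "\<dots> = r" using r D by (simp add: c_def)
      finally have "x \<in> ball ((1 / c) *\<^sub>R l) r"
        by (simp add: dist_norm norm_minus_commute)
      with \<open>l \<in> A\<close> show "x \<in> (\<Union>z\<in>G. ball z r)" by (auto simp: G_def)
    qed
    fix x :: 'a
    define B where "B = {l \<in> cball (c *\<^sub>R x) (4 * D). \<forall>b\<in>Basis. l \<bullet> b \<in> \<int>}"
    have "{z\<in>G. dist z x < 4 * r} \<subseteq> (\<lambda>l. (1 / c) *\<^sub>R l) ` B"
    proof
      fix z assume z: "z \<in> {z\<in>G. dist z x < 4 * r}"
      then obtain l where l: "l \<in> A" "z = (1 / c) *\<^sub>R l" by (auto simp: G_def)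
      have "c *\<^sub>R x - l = c *\<^sub>R (x - z)" using c l by (simp add: scaleR_diff_right)
      then have "norm (c *\<^sub>R x - l) = c * norm (x - z)" using c by simp
      also have "\<dots> \<le> c * (4 * r)"
        using z c by (intro mult_left_mono) (auto simp: dist_norm norm_minus_commute)
      also have "\<dots> = 4 * D" using r by (simp add: c_def)
      finally show "z \<in> (\<lambda>l. (1 / c) *\<^sub>R l) ` B"
        using l by (auto simp: B_def A_def dist_norm)
    qed
    moreover have TB: "0 \<le> 4 * D" using D by simp
    have "finite B" unfolding B_def by (rule card_integer_points_cball(1)[OF TB])
    ultimately have "card {z\<in>G. dist z x < 4 * r} \<le> card B"
      by (meson card_image_le card_mono finite_imageI order_trans)
    moreover have "real (card B) \<le> K"
      unfolding B_def K_def by (rule card_integer_points_cball(2)[OF TB])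
    ultimately show "real (card {z\<in>G. dist z x < 4 * r}) \<le> K" by linarith
  qed
  then show ?thesis by blast
qed

section \<open>Measure-preserving maps and Kac's lemma\<close>

text \<open>
  A Borel probability measure on a Euclidean space and a measurable map that preserves it.
\<close>
locale measure_preserving_map = prob_space M
  for M :: "'a::euclidean_space measure" and f :: "'a \<Rightarrow> 'a" +
  assumes sets_M: "sets M = sets borel"
    and measurable_f: "f \<in> measurable M M"
    and distr_f: "distr M M f = M"
begin

lemma space_M [simp]: "space M = UNIV"
  using sets_eq_imp_space_eq[OF sets_M] by simp

lemma open_in_sets [measurable]: "open A \<Longrightarrow> A \<in> sets M"
  by (simp add: sets_M)

lemma measurable_iterate [measurable]: "(f ^^ n) \<in> measurable M M"
  by (induction n) (auto intro: measurable_comp[OF _ measurable_f] simp del: comp_apply simp: id_def)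

lemma distr_iterate: "distr M M (f ^^ n) = M"
proof (induction n)
  case (Suc n)
  have "distr M M (f ^^ Suc n) = distr (distr M M (f ^^ n)) M f"
    by (simp add: distr_distr[OF measurable_f measurable_iterate])
  then show ?case using Suc distr_f by (simp only:)
qed (simp add: id_def)

lemma measure_iterate_vimage:
  assumes "A \<in> sets M"
  shows "measure M ((f ^^ n) -` A) = measure M A"
  using measure_distr[OF measurable_iterate[of n] assms] distr_iterate[of n] by simp

lemma pred_iterate_mem:
  assumes "A \<in> sets M"
  shows "Measurable.pred M (\<lambda>x. (f ^^ n) x \<in> A)" and "Measurable.pred M (\<lambda>x. x \<in> A)"
  using measurable_sets[OF measurable_iterate[of n] assms] assms
  by (simp_all add: pred_def vimage_def)

text \<open>
  A form of Kac's lemma. The set in question is contained in \<open>E j\<close> for each \<open>j \<le> k\<close>, and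
  the pullback of \<open>E j\<close> under \<open>f ^^ (k - j)\<close> consists of the points whose last visit to \<open>Q\<close> in the
  time window from \<open>0\<close> to \<open>k\<close> happens at time \<open>k - j\<close>. These pullbacks are disjoint.
\<close>
lemma measure_no_return_le:
  assumes Q: "Q \<in> sets M"
  shows "(real k + 1) * measure M {x \<in> Q. \<forall>j\<in>{1..k}. (f ^^ j) x \<notin> Q} \<le> 1"
proof -
  define E where "E j = {x \<in> Q. \<forall>i\<in>{1..j}. (f ^^ i) x \<notin> Q}" for j
  define D where "D j = (f ^^ (k - j)) -` E j" for j
  have E [measurable]: "E j \<in> sets M" for j
  proof -
    note [measurable] = pred_iterate_mem[OF Q]
    have "{x \<in> space M. x \<in> Q \<and> (\<forall>i\<in>{1..j}. (f ^^ i) x \<notin> Q)} \<in> sets M"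
      by measurable
    then show ?thesis by (simp add: E_def)
  qed
  have Dsets: "D j \<in> sets M" for j
    using measurable_sets[OF measurable_iterate[of "k - j"] E[of j]] by (simp add: D_def)
  have neq: "D j \<inter> D j' = {}" if "j < j'" "j' \<le> k" for j j'
  proof (rule equals0I)
    fix y assume y: "y \<in> D j \<inter> D j'"
    then have "(f ^^ (j' - j)) ((f ^^ (k - j')) y) \<notin> Q"
      using that by (auto simp: D_def E_def)
    then have "(f ^^ (k - j)) y \<notin> Q"
      using that by (simp add: funpow_add[symmetric, THEN fun_cong, unfolded comp_apply])
    then show False using y by (auto simp: D_def E_def)
  qed
  have disj: "disjoint_family_on D {..k}"
    unfolding disjoint_family_on_def using neq
    by (metis Int_commute atMost_iff linorder_neqE_nat)
  have "(real k + 1) * measure M (E k) = (\<Sum>j\<in>{..k}. measure M (E k))"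
    by simp
  also have "\<dots> \<le> (\<Sum>j\<in>{..k}. measure M (E j))"
    by (intro sum_mono finite_measure_mono E) (auto simp: E_def)
  also have "\<dots> = (\<Sum>j\<in>{..k}. measure M (D j))"
    by (simp add: D_def measure_iterate_vimage)
  also have "\<dots> = measure M (\<Union>j\<in>{..k}. D j)"
    by (rule finite_measure_finite_Union[symmetric]) (use Dsets disj in auto)
  also have "\<dots> \<le> 1" by (rule prob_le_1)
  finally show ?thesis by (simp add: E_def)
qed

lemma sum_measure_ball_le:
  assumes "finite G" "\<And>x. real (card {z\<in>G. dist z x < s}) \<le> K"
  shows "(\<Sum>z\<in>G. measure M (ball z s)) \<le> K"
proof -
  have "(\<Sum>z\<in>G. measure M (ball z s)) = (\<Sum>z\<in>G. \<integral>x. indicator (ball z s) x \<partial>M)"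
    by simp
  also have "\<dots> = (\<integral>x. (\<Sum>z\<in>G. indicator (ball z s) x) \<partial>M)"
    by (rule Bochner_Integration.integral_sum[symmetric])
       (auto intro!: integrable_real_indicator simp: open_in_sets emeasure_eq_measure)
  also have "\<dots> \<le> (\<integral>x. K \<partial>M)"
  proof (rule integral_mono)
    show "integrable M (\<lambda>x. \<Sum>z\<in>G. indicator (ball z s) x :: real)"
      by (auto intro!: integrable_real_indicator simp: open_in_sets emeasure_eq_measure)
    fix x
    have "(\<Sum>z\<in>G. indicator (ball z s) x :: real) = real (card {z\<in>G. dist z x < s})"
      using assms(1) by (simp add: indicator_def sum.If_cases Int_def)
    then show "(\<Sum>z\<in>G. indicator (ball z s) x) \<le> K" using assms(2) by simp
  qed simp
  finally show ?thesis using prob_space by simp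
qed

section \<open>Returns at a single scale\<close>

text \<open>
  At scale \<open>r\<close>, some return of \<open>x\<close> occurs no later than \<open>1 / (u * \<mu> (B x r))\<close>. The product form
  is also meaningful for a null ball.
\<close>
definition quick_return :: "real \<Rightarrow> real \<Rightarrow> 'a \<Rightarrow> bool" where
  "quick_return u r x \<longleftrightarrow>
     (\<exists>j\<ge>1. dist ((f ^^ j) x) x < r \<and> real j * measure M (ball x r) \<le> 1 / u)"

text \<open>
  At scale \<open>r\<close>, no return of \<open>x\<close> occurs between the times \<open>r powr -a\<close> and \<open>u / \<mu> (B x (4 * r))\<close>;
  earlier returns are not excluded. If \<open>ball x (4 * r)\<close> is null and \<open>u \<ge> 0\<close>, no return at all
  occurs from time \<open>r powr -a\<close> on.
\<close>
definition slow_return :: "real \<Rightarrow> real \<Rightarrow> real \<Rightarrow> 'a \<Rightarrow> bool" where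
  "slow_return a u r x \<longleftrightarrow> (\<forall>k. r powr -a \<le> real k \<and> dist ((f ^^ k) x) x < r \<longrightarrow>
     u < real k * measure M (ball x (4 * r)))"

text \<open>
  The correlations at time \<open>n\<close> of functions supported in \<open>V\<close> are controlled by \<open>\<theta> n\<close>.
\<close>
definition correlation_bound :: "'a set \<Rightarrow> (nat \<Rightarrow> real) \<Rightarrow> bool" where
  "correlation_bound V \<theta> \<longleftrightarrow> (\<forall>n \<phi> \<psi>.
     bounded_lipschitz \<phi> \<and> bounded_lipschitz \<psi> \<and>
     closed_support \<phi> \<subseteq> V \<and> closed_support \<psi> \<subseteq> V \<longrightarrow>
     \<bar>(\<integral>x. \<phi> ((f ^^ n) x) * \<psi> x \<partial>M) - (\<integral>x. \<phi> x \<partial>M) * (\<integral>x. \<psi> x \<partial>M)\<bar>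
       \<le> lipschitz_norm \<phi> * lipschitz_norm \<psi> * \<theta> n)"

text \<open>
  Each ball \<open>Q\<close> of radius \<open>r / 2\<close> contributes the set \<open>E z\<close> of points that do not return to \<open>Q\<close> in
  time. A return to \<open>Q\<close> is a return to within distance \<open>r\<close>.
\<close>
lemma quick_return_one_scale:
  "\<exists>K. \<forall>R r u. 0 < R \<and> 0 < r \<and> r \<le> 1 \<and> 0 < u \<longrightarrow>
     (\<exists>W\<in>sets M. measure M W \<le> K * u \<and> (\<forall>x\<in>ball 0 R - W. quick_return u r x))"
proof -
  obtain K :: real where
    cover: "\<forall>R>0. \<exists>C\<ge>0. \<forall>r. 0 < r \<and> r \<le> 1 \<longrightarrow>
      (\<exists>G::'a set. ball_cover R r K G \<and> real (card G) \<le> C * (1 / r) ^ DIM('a))"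
    using bounded_multiplicity_cover[where 'a = 'a] ..
  have "\<exists>W\<in>sets M. measure M W \<le> K * u \<and> (\<forall>x\<in>ball 0 R - W. quick_return u r x)"
    if R: "0 < R" and r: "0 < r" "r \<le> 1" and u: "0 < u" for R r u
  proof -
    have r2: "0 < r / 2 \<and> r / 2 \<le> 1" using r by simp
    obtain G :: "'a set" where G: "finite G" "ball 0 R \<subseteq> (\<Union>z\<in>G. ball z (r / 2))"
      and mult: "\<And>x. real (card {z\<in>G. dist z x < 4 * (r / 2)}) \<le> K"
    proof -
      obtain C where "\<forall>r. 0 < r \<and> r \<le> 1 \<longrightarrow>
          (\<exists>G::'a set. ball_cover R r K G \<and> real (card G) \<le> C * (1 / r) ^ DIM('a))"
        using cover R by meson
      with r2 that show thesis unfolding ball_cover_def by blast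
    qed
    define m where "m z = measure M (ball z (2 * r))" for z
    define E where "E z = {x \<in> ball z (r / 2). \<forall>j. 1 \<le> j \<and> real j * m z \<le> 1 / u \<longrightarrow>
        (f ^^ j) x \<notin> ball z (r / 2)}" for z
    have E [measurable]: "E z \<in> sets M" for z
    proof -
      note [measurable] = pred_iterate_mem[OF open_in_sets[OF open_ball[of z "r / 2"]]]
      have "{x \<in> space M. x \<in> ball z (r / 2) \<and> (\<forall>j. 1 \<le> j \<and> real j * m z \<le> 1 / u \<longrightarrow>
        (f ^^ j) x \<notin> ball z (r / 2))} \<in> sets M"
        by measurable
      then show ?thesis by (simp add: E_def)
    qed
    have small: "measure M (E z) \<le> u * m z" for z
    proof (cases "m z = 0")
      case True
      have "measure M (E z) \<le> m z"
        unfolding m_def using r by (intro finite_measure_mono) (auto simp: E_def open_in_sets)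
      then show ?thesis using True by simp
    next
      case False
      then have mz: "0 < m z" by (simp add: m_def zero_less_measure_iff)
      define t where "t = 1 / (u * m z)"
      define k where "k = nat \<lfloor>t\<rfloor>"
      have t: "0 < t" using mz u by (simp add: t_def)
      have kt: "real k \<le> t" "t \<le> real k + 1" using t by (auto simp: k_def)
      let ?N = "{x \<in> ball z (r / 2). \<forall>j\<in>{1..k}. (f ^^ j) x \<notin> ball z (r / 2)}"
      have "E z \<subseteq> ?N"
      proof -
        have "real j * m z \<le> 1 / u" if "j \<le> k" for j
        proof -
          have "real j \<le> t" using that kt by linarith
          then show ?thesis using mz u by (simp add: t_def field_simps)
        qed
        then show ?thesis by (auto simp: E_def)
      qed
      moreover have "?N \<in> sets M"
      proof -
        note [measurable] = pred_iterate_mem[OF open_in_sets[OF open_ball[of z "r / 2"]]]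
        have "{x \<in> space M. x \<in> ball z (r / 2) \<and> (\<forall>j\<in>{1..k}. (f ^^ j) x \<notin> ball z (r / 2))} \<in> sets M"
          by measurable
        then show ?thesis by simp
      qed
      ultimately have "measure M (E z) \<le> measure M ?N" by (rule finite_measure_mono)
      then have "t * measure M (E z) \<le> (real k + 1) * measure M ?N"
        using kt t by (intro mult_mono) auto
      also have "\<dots> \<le> 1" by (rule measure_no_return_le) (simp add: open_in_sets)
      finally show ?thesis using mz u by (simp add: t_def field_simps)
    qed
    define W where "W = (\<Union>z\<in>G. E z)"
    have "W \<in> sets M" unfolding W_def using G E by (intro sets.finite_UN) auto
    moreover have "measure M W \<le> K * u"
    proof -
      have "measure M W \<le> (\<Sum>z\<in>G. measure M (E z))"
        unfolding W_def by (rule finite_measure_subadditive_finite) (use G E in auto)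
      also have "\<dots> \<le> (\<Sum>z\<in>G. u * m z)" by (rule sum_mono) (rule small)
      also have "\<dots> = u * (\<Sum>z\<in>G. measure M (ball z (4 * (r / 2))))"
        by (simp add: m_def sum_distrib_left)
      also have "\<dots> \<le> u * K"
        using u by (intro mult_left_mono sum_measure_ball_le G mult) auto
      finally show ?thesis by (simp add: mult.commute)
    qed
    moreover have "quick_return u r x" if x: "x \<in> ball 0 R - W" for x
    proof -
      obtain z where z: "z \<in> G" "x \<in> ball z (r / 2)" using x G by blast
      have "x \<notin> E z" using x z by (auto simp: W_def)
      then obtain j where j: "1 \<le> j" "real j * m z \<le> 1 / u" "(f ^^ j) x \<in> ball z (r / 2)"
        using z by (auto simp: E_def)
      have "dist ((f ^^ j) x) x < r"
        using dist_triangle[of "(f ^^ j) x" x z] z(2) j(3) by (simp add: dist_commute)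
      moreover have "ball x r \<subseteq> ball z (2 * r)"
      proof
        fix y assume "y \<in> ball x r"
        then show "y \<in> ball z (2 * r)"
          using dist_triangle[of z y x] z(2) r by auto
      qed
      then have "real j * measure M (ball x r) \<le> real j * m z"
        unfolding m_def by (intro mult_left_mono finite_measure_mono) (auto simp: open_in_sets)
      then have "real j * measure M (ball x r) \<le> 1 / u" using j by linarith
      ultimately show ?thesis using j by (auto simp: quick_return_def)
    qed
    ultimately show ?thesis by blast
  qed
  then show ?thesis by blast
qed

end

section \<open>Early returns and decay of correlations\<close>

text \<open>
  For \<open>r > 0\<close>, a Lipschitz function between the indicators of \<open>ball z (2 * r)\<close> and \<open>ball z (3 * r)\<close>.
\<close>
definition bump :: "'a::metric_space \<Rightarrow> real \<Rightarrow> 'a \<Rightarrow> real" where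
  "bump z r y = max 0 (min 1 (3 - dist y z / r))"

lemma bump_nonneg: "0 \<le> bump z r y" and bump_le_1: "bump z r y \<le> 1"
  by (auto simp: bump_def)

lemma indicator_le_bump: "0 < r \<Longrightarrow> indicator (ball z (2 * r)) y \<le> bump z r y"
  by (auto simp: bump_def indicator_def dist_commute field_simps)

lemma bump_le_indicator: "0 < r \<Longrightarrow> bump z r y \<le> indicator (ball z (3 * r)) y"
  by (auto simp: bump_def indicator_def dist_commute field_simps)

lemma closed_support_bump:
  assumes "0 < r" shows "closed_support (bump z r) \<subseteq> cball z (3 * r)"
  unfolding closed_support_def
proof (rule closure_minimal)
  show "{x. bump z r x \<noteq> 0} \<subseteq> cball z (3 * r)"
  proof
    fix y assume y: "y \<in> {x. bump z r x \<noteq> 0}"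
    show "y \<in> cball z (3 * r)"
    proof (rule ccontr)
      assume "y \<notin> cball z (3 * r)"
      then have "3 < dist y z / r" using assms by (simp add: dist_commute field_simps)
      then show False using y by (simp add: bump_def)
    qed
  qed
qed simp

lemma lipschitz_on_bump:
  assumes "0 < r" shows "(1 / r)-lipschitz_on UNIV (bump z r)"
proof (rule lipschitz_onI)
  fix x y
  have "dist (bump z r x) (bump z r y) \<le> \<bar>dist x z / r - dist y z / r\<bar>"
    by (auto simp: bump_def dist_real_def)
  also have "\<dots> = \<bar>dist x z - dist y z\<bar> / r"
    using assms by (simp flip: diff_divide_distrib)
  also have "\<dots> \<le> dist x y / r"
    using assms abs_dist_diff_le[of x z y] by (intro divide_right_mono) (auto simp: dist_commute)
  finally show "dist (bump z r x) (bump z r y) \<le> 1 / r * dist x y" by simp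
qed (use assms in simp)

lemma bounded_lipschitz_bump: "0 < r \<Longrightarrow> bounded_lipschitz (bump z r)"
  unfolding bounded_lipschitz_def
  by (auto intro!: lipschitz_on_bump boundedI[of _ 1] simp: bump_nonneg bump_le_1)

lemma lipschitz_norm_bump:
  assumes "0 < r"
  shows "0 \<le> lipschitz_norm (bump z r)" and "lipschitz_norm (bump z r) \<le> 1 + 1 / r"
proof -
  have bdd: "bdd_above (range (\<lambda>x. \<bar>bump z r x\<bar>))"
    by (auto intro!: bdd_aboveI[of _ 1] simp: bump_nonneg bump_le_1)
  have "0 \<le> (SUP x. \<bar>bump z r x\<bar>)" by (rule cSUP_upper2[OF bdd, of z]) auto
  moreover have "(SUP x. \<bar>bump z r x\<bar>) \<le> 1"
    by (rule cSUP_least) (auto simp: bump_nonneg bump_le_1)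
  moreover have "0 \<le> Inf {C. C-lipschitz_on UNIV (bump z r)}"
    by (rule cInf_greatest) (use lipschitz_on_bump[OF assms] in \<open>auto dest: lipschitz_on_nonneg\<close>)
  moreover have "Inf {C. C-lipschitz_on UNIV (bump z r)} \<le> 1 / r"
    by (rule cInf_lower)
      (use lipschitz_on_bump[OF assms] in \<open>auto intro!: bdd_belowI[of _ 0] dest: lipschitz_on_nonneg\<close>)
  ultimately show "0 \<le> lipschitz_norm (bump z r)" "lipschitz_norm (bump z r) \<le> 1 + 1 / r"
    by (auto simp: lipschitz_norm_def)
qed

context measure_preserving_map
begin

lemma measurable_bump: "bump z r \<in> borel_measurable M"
proof -
  have "continuous_on UNIV (bump z r)"
    unfolding bump_def by (cases "r = 0") (auto intro!: continuous_intros)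
  then have "bump z r \<in> borel_measurable borel" by (rule borel_measurable_continuous_onI)
  then show ?thesis by (simp add: measurable_cong_sets[OF sets_M refl])
qed

text \<open>
  Approximate independence of being in a ball now and at time \<open>n\<close>.
\<close>
lemma measure_ball_inter_return_le:
  fixes V :: "'a set" and \<theta> :: "nat \<Rightarrow> real"
  assumes corr: "correlation_bound V \<theta>"
    and r: "0 < r" and V: "cball z (3 * r) \<subseteq> V" and \<theta>: "\<theta> n \<le> c" "0 \<le> c"
  shows "measure M (ball z (2 * r) \<inter> (f ^^ n) -` ball z (2 * r))
    \<le> (measure M (ball z (3 * r)))\<^sup>2 + (1 + 1 / r)\<^sup>2 * c"
proof -
  let ?\<phi> = "bump z r"
  let ?S = "ball z (2 * r) \<inter> (f ^^ n) -` ball z (2 * r)"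
  have [measurable]: "?\<phi> \<in> borel_measurable M" by (rule measurable_bump)
  have S: "?S \<in> sets M"
    using measurable_sets[OF measurable_iterate[of n] open_in_sets[OF open_ball[of z "2 * r"]]]
    by (auto intro!: sets.Int open_in_sets)
  have int1: "integrable M (\<lambda>x. ?\<phi> ((f ^^ n) x) * ?\<phi> x)"
  proof (rule integrable_const_bound[where B = 1])
    show "(\<lambda>x. ?\<phi> ((f ^^ n) x) * ?\<phi> x) \<in> borel_measurable M" by measurable
    show "AE x in M. norm (?\<phi> ((f ^^ n) x) * ?\<phi> x) \<le> 1"
      by (auto simp: bump_nonneg bump_le_1 intro!: mult_le_one)
  qed
  have int2: "integrable M ?\<phi>"
    by (rule integrable_const_bound[where B = 1]) (auto simp: bump_nonneg bump_le_1)
  have "measure M ?S = (\<integral>x. indicator ?S x \<partial>M)" by simp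
  also have "\<dots> \<le> (\<integral>x. ?\<phi> ((f ^^ n) x) * ?\<phi> x \<partial>M)"
  proof (rule integral_mono[OF _ int1])
    show "integrable M (indicator ?S :: 'a \<Rightarrow> real)"
      using S by (auto intro!: integrable_real_indicator simp: emeasure_eq_measure)
    fix x
    have "indicator ?S x = (indicator (ball z (2 * r)) ((f ^^ n) x) * indicator (ball z (2 * r)) x :: real)"
      by (auto simp: indicator_def)
    also have "\<dots> \<le> ?\<phi> ((f ^^ n) x) * ?\<phi> x"
      using indicator_le_bump[OF r] by (intro mult_mono) (auto simp: bump_nonneg)
    finally show "indicator ?S x \<le> ?\<phi> ((f ^^ n) x) * ?\<phi> x" .
  qed
  also have "\<dots> \<le> (\<integral>x. ?\<phi> x \<partial>M) * (\<integral>x. ?\<phi> x \<partial>M) + lipschitz_norm ?\<phi> * lipschitz_norm ?\<phi> * \<theta> n"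
  proof -
    have "closed_support ?\<phi> \<subseteq> V" using closed_support_bump[OF r] V by (rule subset_trans)
    then have "\<bar>(\<integral>x. ?\<phi> ((f ^^ n) x) * ?\<phi> x \<partial>M) - (\<integral>x. ?\<phi> x \<partial>M) * (\<integral>x. ?\<phi> x \<partial>M)\<bar>
        \<le> lipschitz_norm ?\<phi> * lipschitz_norm ?\<phi> * \<theta> n"
      using corr bounded_lipschitz_bump[OF r, of z] unfolding correlation_bound_def by blast
    then show ?thesis by linarith
  qed
  also have "\<dots> \<le> measure M (ball z (3 * r)) * measure M (ball z (3 * r)) + (1 + 1 / r) * (1 + 1 / r) * c"
  proof (rule add_mono)
    have "(\<integral>x. ?\<phi> x \<partial>M) \<le> (\<integral>x. indicator (ball z (3 * r)) x \<partial>M)"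
      using bump_le_indicator[OF r]
      by (intro integral_mono int2)
         (auto intro!: integrable_real_indicator simp: open_in_sets emeasure_eq_measure)
    then have le: "(\<integral>x. ?\<phi> x \<partial>M) \<le> measure M (ball z (3 * r))" by simp
    have "0 \<le> (\<integral>x. ?\<phi> x \<partial>M)" by (simp add: bump_nonneg)
    then show "(\<integral>x. ?\<phi> x \<partial>M) * (\<integral>x. ?\<phi> x \<partial>M) \<le> measure M (ball z (3 * r)) * measure M (ball z (3 * r))"
      using le by (intro mult_mono) auto
    have nn: "0 \<le> lipschitz_norm ?\<phi> * lipschitz_norm ?\<phi>"
      by simp
    have "lipschitz_norm ?\<phi> * lipschitz_norm ?\<phi> * \<theta> n \<le> lipschitz_norm ?\<phi> * lipschitz_norm ?\<phi> * c"
      using \<theta> nn by (intro mult_left_mono) auto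
    also have "\<dots> \<le> (1 + 1 / r) * (1 + 1 / r) * c"
      using lipschitz_norm_bump[OF r, of z] \<theta> r by (intro mult_right_mono mult_mono) auto
    finally show "lipschitz_norm ?\<phi> * lipschitz_norm ?\<phi> * \<theta> n \<le> (1 + 1 / r) * (1 + 1 / r) * c" .
  qed
  finally show ?thesis by (simp add: power2_eq_square)
qed

text \<open>
  The error \<open>C * r\<close> comes from the correlation bounds. Only balls of the cover with a
  neighbourhood inside \<open>V\<close> are usable, whence the condition that \<open>ball x (5 * r)\<close> lies in \<open>V\<close>.
\<close>
lemma slow_return_one_scale:
  fixes V :: "'a set" and \<theta> :: "nat \<Rightarrow> real"
  assumes corr: "correlation_bound V \<theta>"
    and decay: "\<And>p. 0 < p \<Longrightarrow> (\<lambda>n. real n powr p * \<theta> n) \<longlonglongrightarrow> 0"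
    and a: "0 < a" and R: "0 < R"
  shows "\<exists>K C. \<exists>r0>0. \<forall>r u. 0 < r \<and> r < r0 \<and> 0 < u \<longrightarrow>
    (\<exists>W\<in>sets M. measure M W \<le> K * u + C * r \<and>
      (\<forall>x\<in>ball 0 R - W. ball x (5 * r) \<subseteq> V \<longrightarrow> slow_return a u r x))"
proof -
  obtain K :: real where
    cover: "\<forall>R>0. \<exists>C\<ge>0. \<forall>r. 0 < r \<and> r \<le> 1 \<longrightarrow>
      (\<exists>G::'a set. ball_cover R r K G \<and> real (card G) \<le> C * (1 / r) ^ DIM('a))"
    using bounded_multiplicity_cover[where 'a = 'a] ..
  obtain C where C: "0 \<le> C" and
    cover: "\<And>r. 0 < r \<Longrightarrow> r \<le> 1 \<Longrightarrow>
      \<exists>G::'a set. ball_cover R r K G \<and> real (card G) \<le> C * (1 / r) ^ DIM('a)"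
    using cover R by meson
  \<comment> \<open>The exponent is chosen so that \<open>k powr -q \<le> r ^ (DIM('a) + 3)\<close> for \<open>k \<ge> r powr -a\<close>: the powers
    absorb \<open>(1 / r)\<^sup>2\<close> from the Lipschitz norms and \<open>(1 / r) ^ DIM('a)\<close> from the number of balls,
    and leave one factor \<open>r\<close>. The further decay \<open>1 / k\<^sup>2\<close> makes the sum over \<open>k\<close> converge.\<close>
  define q where "q = (real DIM('a) + 3) / a"
  have q: "0 < q" "a * q = real (DIM('a) + 3)" using a by (simp_all add: q_def add_pos_nonneg)
  define S where "S = (\<Sum>n. inverse ((real n)\<^sup>2))"
  have summ: "summable (\<lambda>n. inverse ((real n)\<^sup>2))"
    using inverse_power_summable[of 2, where 'a = real] by simp
  have "eventually (\<lambda>n. real n powr (q + 2) * \<theta> n < 1) sequentially"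
    using decay[of "q + 2"] q by (intro order_tendstoD) auto
  then obtain k0 where k0: "\<And>k. k \<ge> k0 \<Longrightarrow> real k powr (q + 2) * \<theta> k < 1"
    by (auto simp: eventually_sequentially)
  \<comment> \<open>For \<open>r < r0\<close> every \<open>k \<ge> r powr -a\<close> is positive and at least \<open>k0\<close>.\<close>
  define r0 where "r0 = min 1 ((real k0 + 1) powr (- (1 / a)))"
  have r0: "0 < r0" "r0 \<le> 1" by (auto simp: r0_def)
  have "\<exists>W\<in>sets M. measure M W \<le> K * u + (4 * S * C) * r \<and>
      (\<forall>x\<in>ball 0 R - W. ball x (5 * r) \<subseteq> V \<longrightarrow> slow_return a u r x)"
    if r: "0 < r" "r < r0" and u: "0 < u" for r u
  proof -
    have r1: "r \<le> 1" using r r0 by simp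
    have late: "1 \<le> k \<and> \<theta> k \<le> r ^ (DIM('a) + 3) * inverse ((real k)\<^sup>2)"
      if k: "r powr -a \<le> real k" for k
    proof -
      have "real k0 + 1 = ((real k0 + 1) powr (- (1 / a))) powr -a"
        using a by (simp add: powr_powr)
      also have "\<dots> \<le> r powr -a"
        using r a by (intro powr_mono2') (auto simp: r0_def)
      finally have kk: "k0 \<le> k" "1 \<le> k" using k by auto
      have "\<theta> k \<le> real k powr - (q + 2)"
      proof -
        have "real k powr (q + 2) * \<theta> k \<le> 1" using k0[OF kk(1)] by simp
        moreover have "0 < real k powr (q + 2)" using kk by simp
        ultimately show ?thesis
          by (simp only: powr_minus_divide) (simp add: pos_le_divide_eq mult.commute)
      qed
      also have "\<dots> = real k powr - q * inverse ((real k)\<^sup>2)"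
      proof -
        have "real k powr - (q + 2) = real k powr - q * real k powr - 2"
          by (simp flip: powr_add)
        also have "real k powr - 2 = inverse ((real k)\<^sup>2)"
          using kk by (simp add: powr_minus)
        finally show ?thesis .
      qed
      also have "\<dots> \<le> (r powr -a) powr - q * inverse ((real k)\<^sup>2)"
        using k q r by (intro mult_right_mono powr_mono2') auto
      also have "(r powr -a) powr - q = r ^ (DIM('a) + 3)"
        using q r by (simp only: powr_powr minus_mult_minus powr_realpow)
      finally show ?thesis using kk by simp
    qed
    obtain G :: "'a set" where G: "finite G" "real (card G) \<le> C * (1 / r) ^ DIM('a)"
        "ball 0 R \<subseteq> (\<Union>z\<in>G. ball z r)"
      and mult: "\<And>x. real (card {z\<in>G. dist z x < 4 * r}) \<le> K"
      using cover[OF r(1) r1] unfolding ball_cover_def by auto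
    define G' where "G' = {z \<in> G. cball z (3 * r) \<subseteq> V}"
    define m where "m z = measure M (ball z (3 * r))" for z
    define I where "I z = {k. r powr -a \<le> real k \<and> real k * m z \<le> u}" for z
    define P where "P z k = ball z (2 * r) \<inter> (f ^^ k) -` ball z (2 * r)" for z k
    define E where "E z = (\<Union>k\<in>I z. P z k)" for z
    have P: "P z k \<in> sets M" for z k
      using measurable_sets[OF measurable_iterate[of k] open_in_sets[OF open_ball[of z "2 * r"]]]
      by (auto simp: P_def intro!: sets.Int open_in_sets)
    have E: "E z \<in> sets M" for z
      unfolding E_def using P by (intro sets.countable_UN') auto
    have small: "measure M (E z) \<le> u * m z + 4 * S * r ^ (DIM('a) + 1)" if z: "z \<in> G'" for z
    proof (cases "m z = 0")
      case True
      have "measure M (E z) \<le> m z"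
        unfolding m_def using r by (intro finite_measure_mono) (auto simp: E_def P_def open_in_sets)
      then have "measure M (E z) \<le> 0" using True by simp
      moreover have "0 \<le> 4 * S * r ^ (DIM('a) + 1)"
        using r unfolding S_def by (intro mult_nonneg_nonneg suminf_nonneg summ) auto
      ultimately show ?thesis using True by simp
    next
      case False
      then have mz: "0 < m z" by (simp add: m_def zero_less_measure_iff)
      have sub: "I z \<subseteq> {1..nat \<lfloor>u / m z\<rfloor>}"
      proof
        fix k assume k: "k \<in> I z"
        then have "real k \<le> u / m z" using mz by (simp add: I_def field_simps)
        then have "k \<le> nat \<lfloor>u / m z\<rfloor>" by (simp add: le_nat_floor)
        then show "k \<in> {1..nat \<lfloor>u / m z\<rfloor>}" using late[of k] k by (auto simp: I_def)
      qed
      then have fin: "finite (I z)" by (rule finite_subset) simp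
      have "card (I z) \<le> nat \<lfloor>u / m z\<rfloor>" using card_mono[OF _ sub] by simp
      then have "real (card (I z)) \<le> real (nat \<lfloor>u / m z\<rfloor>)" by simp
      also have "\<dots> \<le> u / m z" using u mz by simp
      finally have card: "real (card (I z)) \<le> u / m z" .
      have "measure M (E z) \<le> (\<Sum>k\<in>I z. measure M (P z k))"
        unfolding E_def by (rule finite_measure_subadditive_finite) (use fin P in auto)
      also have "\<dots> \<le> (\<Sum>k\<in>I z. (m z)\<^sup>2 + (1 + 1 / r)\<^sup>2 * (r ^ (DIM('a) + 3) * inverse ((real k)\<^sup>2)))"
        unfolding P_def m_def
        by (intro sum_mono measure_ball_inter_return_le[where V = V and \<theta> = \<theta>] corr)
           (use r z late in \<open>auto simp: G'_def I_def\<close>)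
      also have "\<dots> = real (card (I z)) * (m z)\<^sup>2
          + (1 + 1 / r)\<^sup>2 * r ^ (DIM('a) + 3) * (\<Sum>k\<in>I z. inverse ((real k)\<^sup>2))"
        by (simp add: sum.distrib sum_distrib_left mult.assoc)
      also have "\<dots> \<le> u * m z + 4 * r ^ (DIM('a) + 1) * S"
      proof (rule add_mono)
        have "real (card (I z)) * (m z)\<^sup>2 \<le> u / m z * (m z)\<^sup>2"
          using card by (rule mult_right_mono) simp
        then show "real (card (I z)) * (m z)\<^sup>2 \<le> u * m z"
          using mz by (simp add: power2_eq_square)
        have "(1 + 1 / r)\<^sup>2 * r ^ (DIM('a) + 3) = ((1 + 1 / r) * r)\<^sup>2 * r ^ (DIM('a) + 1)"
          by (simp add: power_mult_distrib power_add power2_eq_square power3_eq_cube)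
        also have "(1 + 1 / r) * r = 1 + r" using r by (simp add: field_simps)
        also have "(1 + r)\<^sup>2 * r ^ (DIM('a) + 1) \<le> 2\<^sup>2 * r ^ (DIM('a) + 1)"
          using r r1 by (intro mult_right_mono power_mono) auto
        finally have 1: "(1 + 1 / r)\<^sup>2 * r ^ (DIM('a) + 3) \<le> 4 * r ^ (DIM('a) + 1)" by simp
        have 2: "(\<Sum>k\<in>I z. inverse ((real k)\<^sup>2)) \<le> S"
          unfolding S_def by (rule sum_le_suminf[OF summ fin]) simp
        show "(1 + 1 / r)\<^sup>2 * r ^ (DIM('a) + 3) * (\<Sum>k\<in>I z. inverse ((real k)\<^sup>2))
            \<le> 4 * r ^ (DIM('a) + 1) * S"
          using r by (intro mult_mono 1 2 sum_nonneg) auto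
      qed
      finally show ?thesis by (simp add: mult_ac)
    qed
    define W where "W = (\<Union>z\<in>G'. E z)"
    have finG': "finite G'" using G by (simp add: G'_def)
    have "W \<in> sets M" unfolding W_def using finG' E by (intro sets.finite_UN) auto
    moreover have "measure M W \<le> K * u + (4 * S * C) * r"
    proof -
      have S0: "0 \<le> S" unfolding S_def by (intro suminf_nonneg summ) auto
      have "measure M W \<le> (\<Sum>z\<in>G'. measure M (E z))"
        unfolding W_def by (rule finite_measure_subadditive_finite) (use finG' E in auto)
      also have "\<dots> \<le> (\<Sum>z\<in>G'. u * m z + 4 * S * r ^ (DIM('a) + 1))"
        by (rule sum_mono) (rule small)
      also have "\<dots> \<le> (\<Sum>z\<in>G. u * m z + 4 * S * r ^ (DIM('a) + 1))"
        using G S0 r u by (intro sum_mono2) (auto simp: G'_def m_def)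
      also have "\<dots> = u * (\<Sum>z\<in>G. m z) + real (card G) * (4 * S * r ^ (DIM('a) + 1))"
        by (simp add: sum.distrib sum_distrib_left)
      also have "\<dots> \<le> u * K + (C * (1 / r) ^ DIM('a)) * (4 * S * r ^ (DIM('a) + 1))"
      proof (intro add_mono mult_left_mono mult_right_mono G)
        have "(\<Sum>z\<in>G. m z) \<le> (\<Sum>z\<in>G. measure M (ball z (4 * r)))"
          unfolding m_def using r
          by (intro sum_mono finite_measure_mono subset_ball) (auto simp: open_in_sets)
        also have "\<dots> \<le> K" by (rule sum_measure_ball_le[OF G(1) mult])
        finally show "(\<Sum>z\<in>G. m z) \<le> K" .
      qed (use u S0 r in auto)
      also have "\<dots> = K * u + (4 * S * C) * r"
        using r by (simp add: power_divide field_simps)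
      finally show ?thesis .
    qed
    moreover have "u < real k * measure M (ball x (4 * r))"
      if x: "x \<in> ball 0 R - W" "ball x (5 * r) \<subseteq> V"
        and k: "r powr -a \<le> real k" "dist ((f ^^ k) x) x < r" for x k
    proof -
      obtain z where z: "z \<in> G" "x \<in> ball z r" using x G by blast
      have "cball z (3 * r) \<subseteq> ball x (5 * r)"
      proof
        fix y assume "y \<in> cball z (3 * r)"
        then show "y \<in> ball x (5 * r)"
          using dist_triangle[of x y z] z(2) r by (auto simp: dist_commute)
      qed
      then have "z \<in> G'" using z x by (auto simp: G'_def)
      then have "x \<notin> E z" using x by (auto simp: W_def)
      moreover have "x \<in> P z k"
        using z(2) k(2) dist_triangle[of z "(f ^^ k) x" x] r by (auto simp: P_def dist_commute)
      ultimately have "k \<notin> I z" by (auto simp: E_def)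
      then have "u < real k * m z" using k by (simp add: I_def)
      also have "\<dots> \<le> real k * measure M (ball x (4 * r))"
      proof -
        have "ball z (3 * r) \<subseteq> ball x (4 * r)"
        proof
          fix y assume "y \<in> ball z (3 * r)"
          then show "y \<in> ball x (4 * r)"
            using dist_triangle[of x y z] z(2) by (auto simp: dist_commute)
        qed
        then show ?thesis
          unfolding m_def by (intro mult_left_mono finite_measure_mono) (auto simp: open_in_sets)
      qed
      finally show ?thesis .
    qed
    ultimately show ?thesis unfolding slow_return_def by blast
  qed
  then show ?thesis using r0(1) by blast
qed

section \<open>Almost every point\<close>

text \<open>
  Borel--Cantelli: the measures of the exceptional sets are summable along the dyadic radii.
\<close>
lemma AE_eventually_dyadic:
  fixes \<Phi> :: "real \<Rightarrow> 'a \<Rightarrow> bool"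
  assumes r0: "0 < r0" and e: "0 < e"
    and W: "\<And>r. 0 < r \<Longrightarrow> r < r0 \<Longrightarrow>
      \<exists>W\<in>sets M. measure M W \<le> K * r powr e + C * r \<and> (\<forall>x\<in>B - W. \<Phi> r x)"
  shows "AE x in M. x \<in> B \<longrightarrow> eventually (\<lambda>n. \<Phi> ((1 / 2) ^ n) x) sequentially"
proof -
  have "\<exists>W. W \<in> sets M \<and> ((1 / 2) ^ n < r0 \<longrightarrow>
      measure M W \<le> K * ((1 / 2) ^ n) powr e + C * (1 / 2) ^ n \<and> (\<forall>x\<in>B - W. \<Phi> ((1 / 2) ^ n) x))" for n :: nat
    using W[of "(1 / 2) ^ n"] by (cases "(1 / 2) ^ n < r0") auto
  then obtain A where A: "\<And>n. A n \<in> sets M"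
    and bound: "\<And>n. (1 / 2) ^ n < r0 \<Longrightarrow> measure M (A n) \<le> K * ((1 / 2) ^ n) powr e + C * (1 / 2) ^ n"
    and good: "\<And>n x. (1 / 2) ^ n < r0 \<Longrightarrow> x \<in> B - A n \<Longrightarrow> \<Phi> ((1 / 2) ^ n) x"
    by metis
  have "(\<lambda>n. (1 / 2 :: real) ^ n) \<longlonglongrightarrow> 0" by (rule LIMSEQ_power_zero) simp
  then have ev: "eventually (\<lambda>n. (1 / 2) ^ n < r0) sequentially"
    using r0 by (rule order_tendstoD)
  have "(1 / 2 :: real) powr e < (1 / 2) powr 0" using e by (intro powr_less_mono') auto
  then have "summable (\<lambda>n. K * ((1 / 2) powr e) ^ n + C * (1 / 2) ^ n)"
    by (intro summable_add summable_mult summable_geometric) (auto simp: powr_ge_zero)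
  moreover have "((1 / 2) ^ n) powr e = ((1 / 2 :: real) powr e) ^ n" for n
    by (simp add: powr_powr mult.commute flip: powr_realpow)
  ultimately have "summable (\<lambda>n. K * ((1 / 2) ^ n) powr e + C * (1 / 2) ^ n)" by simp
  then have "summable (\<lambda>n. measure M (A n))"
    by (rule summable_comparison_test_ev[rotated]) (use ev bound in \<open>auto elim: eventually_mono\<close>)
  then have "AE x in M. eventually (\<lambda>n. x \<in> space M - A n) sequentially"
    by (intro borel_cantelli_AE1 A) (simp_all add: emeasure_eq_measure)
  then show ?thesis
  proof eventually_elim
    case (elim x)
    show ?case
    proof
      assume "x \<in> B"
      from elim ev show "eventually (\<lambda>n. \<Phi> ((1 / 2) ^ n) x) sequentially"
      proof eventually_elim
        case (elim n)
        then show ?case using good[of n x] \<open>x \<in> B\<close> by blast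
      qed
    qed
  qed
qed

lemma in_ball_Suc: "\<exists>N::nat. (x::'a) \<in> ball 0 (real (Suc N))"
proof -
  obtain N :: nat where "norm x < real N" using reals_Archimedean2 by blast
  then show ?thesis by (intro exI[of _ N]) simp
qed

lemma AE_quick_return:
  assumes e: "0 < e"
  shows "AE x in M. eventually (\<lambda>n. quick_return (((1 / 2) ^ n) powr e) ((1 / 2) ^ n) x) sequentially"
proof -
  obtain K where K: "\<forall>R r u. 0 < R \<and> 0 < r \<and> r \<le> 1 \<and> 0 < u \<longrightarrow>
     (\<exists>W\<in>sets M. measure M W \<le> K * u \<and> (\<forall>x\<in>ball 0 R - W. quick_return u r x))"
    using quick_return_one_scale ..
  have "AE x in M. x \<in> ball 0 (real (Suc N)) \<longrightarrow>
      eventually (\<lambda>n. quick_return (((1 / 2) ^ n) powr e) ((1 / 2) ^ n) x) sequentially" for N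
  proof (rule AE_eventually_dyadic[OF zero_less_one e])
    fix r :: real assume "0 < r" "r < 1"
    then show "\<exists>W\<in>sets M. measure M W \<le> K * r powr e + 0 * r \<and>
        (\<forall>x\<in>ball 0 (real (Suc N)) - W. quick_return (r powr e) r x)"
      using K[rule_format, of "real (Suc N)" r "r powr e"] by simp
  qed
  then have "AE x in M. \<forall>N. x \<in> ball 0 (real (Suc N)) \<longrightarrow>
      eventually (\<lambda>n. quick_return (((1 / 2) ^ n) powr e) ((1 / 2) ^ n) x) sequentially"
    by (simp only: AE_all_countable) blast
  then show ?thesis by eventually_elim (use in_ball_Suc in blast)
qed

lemma AE_slow_return:
  fixes V :: "'a set" and \<theta> :: "nat \<Rightarrow> real"
  assumes corr: "correlation_bound V \<theta>"
    and decay: "\<And>p. 0 < p \<Longrightarrow> (\<lambda>n. real n powr p * \<theta> n) \<longlonglongrightarrow> 0"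
    and "open V" and a: "0 < a" and e: "0 < e"
  shows "AE x in M. x \<in> V \<longrightarrow>
    eventually (\<lambda>n. slow_return a (((1 / 2) ^ n) powr e) ((1 / 2) ^ n) x) sequentially"
proof -
  have "AE x in M. x \<in> ball 0 (real (Suc N)) \<longrightarrow>
      eventually (\<lambda>n. ball x (5 * (1 / 2) ^ n) \<subseteq> V \<longrightarrow>
        slow_return a (((1 / 2) ^ n) powr e) ((1 / 2) ^ n) x) sequentially" for N
  proof -
    have N: "0 < real (Suc N)" by simp
    obtain K C r0 where r0: "0 < r0" and bound: "\<forall>r u. 0 < r \<and> r < r0 \<and> 0 < u \<longrightarrow>
      (\<exists>W\<in>sets M. measure M W \<le> K * u + C * r \<and>
        (\<forall>x\<in>ball 0 (real (Suc N)) - W. ball x (5 * r) \<subseteq> V \<longrightarrow> slow_return a u r x))"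
      using slow_return_one_scale[OF corr decay a N] by blast
    show ?thesis
    proof (rule AE_eventually_dyadic[OF r0 e])
      fix r :: real assume "0 < r" "r < r0"
      then show "\<exists>W\<in>sets M. measure M W \<le> K * r powr e + C * r \<and>
          (\<forall>x\<in>ball 0 (real (Suc N)) - W. ball x (5 * r) \<subseteq> V \<longrightarrow> slow_return a (r powr e) r x)"
        by (intro bound[rule_format]) auto
    qed
  qed
  then have "AE x in M. \<forall>N. x \<in> ball 0 (real (Suc N)) \<longrightarrow>
      eventually (\<lambda>n. ball x (5 * (1 / 2) ^ n) \<subseteq> V \<longrightarrow>
        slow_return a (((1 / 2) ^ n) powr e) ((1 / 2) ^ n) x) sequentially"
    by (simp only: AE_all_countable) blast
  then show ?thesis
  proof eventually_elim
    case (elim x)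
    show ?case
    proof
      assume "x \<in> V"
      then obtain d where d: "0 < d" "ball x d \<subseteq> V" using \<open>open V\<close> openE by blast
      have "(\<lambda>n. 5 * (1 / 2 :: real) ^ n) \<longlonglongrightarrow> 5 * 0"
        by (intro tendsto_intros LIMSEQ_power_zero) simp
      then have "eventually (\<lambda>n. 5 * (1 / 2) ^ n < d) sequentially"
        using d(1) by (intro order_tendstoD) auto
      moreover have "eventually (\<lambda>n. ball x (5 * (1 / 2) ^ n) \<subseteq> V \<longrightarrow>
          slow_return a (((1 / 2) ^ n) powr e) ((1 / 2) ^ n) x) sequentially"
        using elim in_ball_Suc[of x] by blast
      ultimately show "eventually (\<lambda>n. slow_return a (((1 / 2) ^ n) powr e) ((1 / 2) ^ n) x) sequentially"
      proof eventually_elim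
        case (elim n)
        then have "ball x (5 * (1 / 2) ^ n) \<subseteq> ball x d" by (intro subset_ball) simp
        then show ?case using elim d by blast
      qed
    qed
  qed
qed

end

section \<open>Logarithmic ratios and return times\<close>

lemma eventually_at_right_0_scale:
  fixes c :: real
  assumes "0 < c" and "eventually P (at_right 0)"
  shows "eventually (\<lambda>r. P (c * r)) (at_right 0)"
  using assms(2) filtermap_times_pos_at_right[OF assms(1), of 0]
  by (metis eventually_filtermap mult_zero_right)

lemma eventually_at_right_0_less: "0 < b \<Longrightarrow> eventually (\<lambda>r::real. 0 < r \<and> r < b) (at_right 0)"
  by (auto simp: eventually_at_right_field)

text \<open>
  Transfer from dyadic radii to all radii: \<open>r\<close> lies between two consecutive good dyadic radii.
\<close>
lemma eventually_dyadic_neighbours: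
  assumes "eventually (\<lambda>n. \<Phi> ((1 / 2 :: real) ^ n)) sequentially"
  shows "eventually (\<lambda>r. \<exists>s>0. s \<le> r \<and> r \<le> 2 * s \<and> \<Phi> s \<and> \<Phi> (2 * s)) (at_right 0)"
proof -
  obtain N where N: "\<And>n. n \<ge> N \<Longrightarrow> \<Phi> ((1 / 2) ^ n)"
    using assms by (auto simp: eventually_sequentially)
  have "\<exists>s>0. s \<le> r \<and> r \<le> 2 * s \<and> \<Phi> s \<and> \<Phi> (2 * s)" if r: "0 < r" "r < (1 / 2) ^ N" for r
  proof -
    define n where "n = (LEAST n. (1 / 2 :: real) ^ n \<le> r)"
    have ex: "\<exists>n. (1 / 2 :: real) ^ n \<le> r"
      using real_arch_pow_inv[OF r(1), of "1 / 2"] by (auto intro: less_imp_le)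
    have le: "(1 / 2) ^ n \<le> r" unfolding n_def by (rule LeastI_ex[OF ex])
    have "N < n"
    proof (rule ccontr)
      assume "\<not> N < n"
      then have "(1 / 2 :: real) ^ N \<le> (1 / 2) ^ n" by (intro power_decreasing) auto
      then show False using le r by linarith
    qed
    then obtain k where k: "n = Suc k" "N \<le> k" by (cases n) auto
    have "\<not> (1 / 2) ^ k \<le> r"
      by (rule not_less_Least) (use k in \<open>simp flip: n_def\<close>)
    then show ?thesis
      using le N[of k] N[of n] k by (intro exI[of _ "(1 / 2) ^ Suc k"]) (auto simp: less_imp_le)
  qed
  then show ?thesis
    using eventually_at_right_0_less[of "(1 / 2) ^ N"] by (auto elim!: eventually_mono)
qed

lemma eventually_ln_inverse_gt: "eventually (\<lambda>r::real. B < ln (1 / r)) (at_right 0)"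
proof -
  have "B < ln (1 / r)" if "0 < r" "r < exp (- B)" for r :: real
  proof -
    have "ln r < - B" using that ln_less_cancel_iff[of r "exp (- B)"] by simp
    then show ?thesis using that by (simp add: ln_div)
  qed
  then show ?thesis
    using eventually_at_right_0_less[of "exp (- B)"] by (auto elim!: eventually_mono)
qed

lemma ereal_le_by_perturbation:
  fixes a b :: ereal
  assumes "0 \<le> b" and le: "\<And>e. 0 < e \<Longrightarrow> a \<le> ereal e + ereal (1 + e) * b"
  shows "a \<le> b"
proof (cases b)
  case (real \<beta>)
  have "a \<le> b + ereal e" if e: "0 < e" for e
  proof -
    have \<beta>: "0 \<le> \<beta>" using assms(1) real by simp
    define d where "d = e / (1 + \<beta>)"
    have d: "0 < d" "d * (1 + \<beta>) = e" using e \<beta> by (simp_all add: d_def)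
    have "a \<le> ereal d + ereal (1 + d) * b" by (rule le[OF d(1)])
    also have "\<dots> = ereal (\<beta> + d * (1 + \<beta>))" using real by (simp add: algebra_simps)
    finally show ?thesis using d real by simp
  qed
  then show ?thesis by (rule ereal_le_epsilon2)
next
  case MInf
  then show ?thesis using assms(1) by simp
qed simp

text \<open>
  Errors of size \<open>e * ln (1 / r)\<close> and a rescaling of the radius are invisible to the lower and
  upper limits of logarithmic ratios, because \<open>ln (1 / (c * r))\<close> and \<open>ln (1 / r)\<close> are asymptotic.
\<close>
lemma log_ratio_le:
  fixes P Q :: "real \<Rightarrow> ereal"
  assumes c: "0 < c" and nonneg: "eventually (\<lambda>r. 0 \<le> Q r) (at_right 0)"
    and le: "\<And>e. 0 < e \<Longrightarrow> eventually (\<lambda>r. P r \<le> ereal (e * ln (1 / r)) + Q (c * r)) (at_right 0)"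
  shows "Liminf (at_right 0) (\<lambda>r. P r / ereal (ln (1 / r))) \<le> Liminf (at_right 0) (\<lambda>r. Q r / ereal (ln (1 / r)))"
    and "Limsup (at_right 0) (\<lambda>r. P r / ereal (ln (1 / r))) \<le> Limsup (at_right 0) (\<lambda>r. Q r / ereal (ln (1 / r)))"
proof -
  define u where "u r = P r / ereal (ln (1 / r))" for r
  define v where "v r = Q r / ereal (ln (1 / r))" for r
  have bot: "at_right (0::real) \<noteq> bot" by simp
  have v0: "eventually (\<lambda>r. 0 \<le> v r) (at_right 0)"
    using nonneg eventually_ln_inverse_gt[of 0]
    by eventually_elim (auto simp: v_def intro!: zero_le_divide_ereal)
  have uv: "eventually (\<lambda>r. u r \<le> ereal e + ereal (1 + e) * v (c * r)) (at_right 0)" if e: "0 < e" for e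
    using le[OF e] eventually_at_right_0_scale[OF c nonneg]
      eventually_at_right_0_scale[OF c eventually_ln_inverse_gt[of 0]]
      eventually_ln_inverse_gt[of 0] eventually_ln_inverse_gt[of "- ln c / e"]
      eventually_at_right_0_less[OF zero_less_one]
  proof eventually_elim
    case (elim r)
    define L where "L = ln (1 / r)"
    define L' where "L' = ln (1 / (c * r))"
    have L: "0 < L" "0 < L'" "- ln c < e * L"
      using elim e by (auto simp: L_def L'_def field_simps)
    have "L' = L - ln c" using elim c by (simp add: L_def L'_def ln_div ln_mult)
    then have LL: "L' \<le> (1 + e) * L" using L by (simp add: algebra_simps)
    show ?case
    proof (cases "Q (c * r)")
      case PInf
      then have "v (c * r) = \<infinity>" using L by (simp add: v_def L'_def)
      then show ?thesis using e by simp
    next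
      case (real q)
      have q: "0 \<le> q" using elim real by simp
      have "P r \<le> ereal (e * L + q)" using elim real by (simp add: L_def)
      then have "u r \<le> ereal (e * L + q) / ereal L"
        unfolding u_def L_def[symmetric] using L by (intro ereal_divide_right_mono) auto
      also have "\<dots> = ereal (e + q / L)" using L by (simp add: field_simps)
      also have "q / L \<le> (1 + e) * (q / L')"
        using mult_left_mono[OF LL q] L by (simp add: field_simps)
      then have "ereal (e + q / L) \<le> ereal (e + (1 + e) * (q / L'))" by simp
      also have "\<dots> = ereal e + ereal (1 + e) * v (c * r)"
        using real L by (simp add: v_def L'_def)
      finally show ?thesis .
    next
      case MInf then show ?thesis using elim by simp
    qed
  qed
  have filt: "filtermap ((*) c) (at_right 0) = at_right 0"
    using filtermap_times_pos_at_right[OF c, of 0] by simp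
  have inj: "inj ((*) c)" using c by (simp add: inj_on_def)
  have sc: "Liminf (at_right 0) (\<lambda>r. v (c * r)) = Liminf (at_right 0) v"
    "Limsup (at_right 0) (\<lambda>r. v (c * r)) = Limsup (at_right 0) v"
    using Liminf_filtermap_eq[OF inj, of "at_right 0" v] Limsup_filtermap_eq[OF inj, of "at_right 0" v]
    by (simp_all add: filt)
  have nn: "0 \<le> Liminf (at_right 0) v" by (rule Liminf_bounded[OF v0])
  show "Liminf (at_right 0) u \<le> Liminf (at_right 0) v"
    unfolding u_def[symmetric] v_def[symmetric]
  proof (rule ereal_le_by_perturbation[OF nn])
    fix e :: real assume e: "0 < e"
    have "Liminf (at_right 0) u \<le> Liminf (at_right 0) (\<lambda>r. ereal e + ereal (1 + e) * v (c * r))"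
      by (rule Liminf_mono[OF uv[OF e]])
    also have "\<dots> = ereal e + ereal (1 + e) * Liminf (at_right 0) v"
      using e by (simp add: Liminf_add_ereal_left[OF bot] Liminf_ereal_mult_left[OF bot] sc)
    finally show "Liminf (at_right 0) u \<le> ereal e + ereal (1 + e) * Liminf (at_right 0) v" .
  qed
  have "Liminf (at_right 0) v \<le> Limsup (at_right 0) v" by (rule Liminf_le_Limsup[OF bot])
  then have nn': "0 \<le> Limsup (at_right 0) v" using nn by (rule order_trans[rotated])
  show "Limsup (at_right 0) u \<le> Limsup (at_right 0) v"
    unfolding u_def[symmetric] v_def[symmetric]
  proof (rule ereal_le_by_perturbation[OF nn'])
    fix e :: real assume e: "0 < e"
    have "Limsup (at_right 0) u \<le> Limsup (at_right 0) (\<lambda>r. ereal e + ereal (1 + e) * v (c * r))"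
      by (rule Limsup_mono[OF uv[OF e]])
    also have "\<dots> = ereal e + ereal (1 + e) * Limsup (at_right 0) v"
      using e by (simp add: Limsup_add_ereal_left[OF bot] Limsup_ereal_mult_left[OF bot] sc)
    finally show "Limsup (at_right 0) u \<le> ereal e + ereal (1 + e) * Limsup (at_right 0) v" .
  qed
qed

lemma return_time_le: "1 \<le> j \<Longrightarrow> dist ((f ^^ j) x) x < r \<Longrightarrow> return_time f r x \<le> enat j"
  unfolding return_time_def by (rule INF_lower) simp

lemma return_time_cases:
  obtains (infinite) "return_time f r x = \<infinity>"
  | (finite) k where "return_time f r x = enat k" "1 \<le> k" "dist ((f ^^ k) x) x < r"
proof (cases "{n. 1 \<le> n \<and> dist ((f ^^ n) x) x < r} = {}")
  case True
  then show ?thesis using infinite unfolding return_time_def True by (simp add: top_enat_def)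
next
  case False
  then obtain n0 where "n0 \<in> {n. 1 \<le> n \<and> dist ((f ^^ n) x) x < r}" by blast
  then have "(INF n\<in>{n. 1 \<le> n \<and> dist ((f ^^ n) x) x < r}. enat n)
      \<in> enat ` {n. 1 \<le> n \<and> dist ((f ^^ n) x) x < r}"
    by (rule wellorder_InfI[OF imageI])
  then show ?thesis using finite unfolding return_time_def by auto
qed

lemma ln_ext_of_nat: "1 \<le> k \<Longrightarrow> ln_ext (ereal_of_enat (enat k)) = ereal (ln (real k))"
  by (simp add: ln_ext_def)

lemma ln_ext_infinity: "ln_ext (ereal_of_enat \<infinity>) = \<infinity>"
  by (simp add: ln_ext_def)

lemma ln_ext_mono: "a \<le> b \<Longrightarrow> ln_ext a \<le> ln_ext b"
  by (cases a; cases b) (auto simp: ln_ext_def)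

section \<open>Recurrence rates and pointwise dimensions\<close>

context measure_preserving_map
begin

text \<open>
  The pointwise part of the argument. The exponents are only required to be available below
  any given bound, so that countably many of them suffice.
\<close>
lemma recurrence_rates_eq_pointwise_dims:
  assumes quick: "\<And>e. 0 < e \<Longrightarrow> \<exists>e'>0. e' \<le> e \<and>
      eventually (\<lambda>n. quick_return (((1 / 2) ^ n) powr e') ((1 / 2) ^ n) x) sequentially"
    and slow: "\<And>a e. 0 < a \<Longrightarrow> 0 < e \<Longrightarrow> \<exists>a'>0. a' \<le> a \<and> (\<exists>e'>0. e' \<le> e \<and>
      eventually (\<lambda>n. slow_return a' (((1 / 2) ^ n) powr e') ((1 / 2) ^ n) x) sequentially)"
    and pos: "0 < lower_recurrence_rate f x"
  shows "lower_recurrence_rate f x = lower_pointwise_dim M x"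
    and "upper_recurrence_rate f x = upper_pointwise_dim M x"
proof -
  define T where "T r = ln_ext (ereal_of_enat (return_time f r x))" for r
  define m where "m r = measure M (ball x r)" for r
  define I where "I r = - ln_ext (enn2ereal (emeasure M (ball x r)))" for r
  have m_mono: "m r \<le> m s" if "r \<le> s" for r s
    unfolding m_def using that by (intro finite_measure_mono subset_ball) (auto simp: open_in_sets)
  have I_eq: "I r = (if m r = 0 then \<infinity> else ereal (- ln (m r)))" for r
    by (simp add: I_def ln_ext_def m_def emeasure_eq_measure enn2ereal_ennreal measure_le_0_iff)
  have I0: "0 \<le> I r" for r
  proof (cases "m r = 0")
    case False
    then have "0 < m r" "m r \<le> 1" by (simp_all add: m_def zero_less_measure_iff)
    then show ?thesis by (simp add: I_eq)
  qed (simp add: I_eq)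
  have T0: "0 \<le> T r" for r
  proof (cases rule: return_time_cases[of f r x])
    case infinite
    then show ?thesis by (simp only: T_def ln_ext_infinity) simp
  next
    case (finite k)
    then have "T r = ereal (ln (real k))" by (simp only: T_def ln_ext_of_nat)
    then show ?thesis using finite(2) by simp
  qed
  have rec: "lower_recurrence_rate f x = Liminf (at_right 0) (\<lambda>r. T r / ereal (ln (1 / r)))"
    "upper_recurrence_rate f x = Limsup (at_right 0) (\<lambda>r. T r / ereal (ln (1 / r)))"
    by (simp_all add: lower_recurrence_rate_def upper_recurrence_rate_def T_def)
  have "eventually (\<lambda>r. ln_ext (enn2ereal (emeasure M (ball x r))) / ereal (ln r)
      = I r / ereal (ln (1 / r))) (at_right 0)"
    using eventually_at_right_0_less[OF zero_less_one]
  proof eventually_elim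
    case (elim r)
    then have "ln (1 / r) = - ln r" "ln r < 0" by (simp_all add: ln_div)
    then show ?case
      unfolding I_def by (cases "ln_ext (enn2ereal (emeasure M (ball x r)))") auto
  qed
  then have dim: "lower_pointwise_dim M x = Liminf (at_right 0) (\<lambda>r. I r / ereal (ln (1 / r)))"
    "upper_pointwise_dim M x = Limsup (at_right 0) (\<lambda>r. I r / ereal (ln (1 / r)))"
    unfolding lower_pointwise_dim_def upper_pointwise_dim_def
    by (auto intro!: Liminf_eq Limsup_eq)
  have T_le_I: "eventually (\<lambda>r. T r \<le> ereal (e * ln (1 / r)) + I (1 / 2 * r)) (at_right 0)" if "0 < e" for e
  proof -
    obtain e' where e': "0 < e'" "e' \<le> e / 2"
      and ev: "eventually (\<lambda>n. quick_return (((1 / 2) ^ n) powr e') ((1 / 2) ^ n) x) sequentially"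
      using quick[of "e / 2"] \<open>0 < e\<close> by auto
    have half: "0 < (1 / 2 :: real)" by simp
    show ?thesis
      using eventually_dyadic_neighbours[OF ev] eventually_at_right_0_less[OF half]
    proof eventually_elim
      case (elim r)
      then obtain s where s: "0 < s" "s \<le> r" "r \<le> 2 * s" and "quick_return (s powr e') s x" by blast
      then obtain j where j: "1 \<le> j" "dist ((f ^^ j) x) x < s" "real j * m s \<le> 1 / s powr e'"
        by (auto simp: quick_return_def m_def)
      have "T r \<le> ln_ext (ereal_of_enat (enat j))"
        unfolding T_def using j s by (intro ln_ext_mono ereal_of_enat_le_iff[THEN iffD2] return_time_le) auto
      then have Tj: "T r \<le> ereal (ln (real j))" by (simp only: ln_ext_of_nat[OF j(1)])
      show ?case
      proof (cases "m (1 / 2 * r) = 0")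
        case True
        then show ?thesis by (simp add: I_eq)
      next
        case False
        then have pos: "0 < m (1 / 2 * r)" by (simp add: m_def zero_less_measure_iff)
        have "real j * m (1 / 2 * r) \<le> real j * m s"
          using s by (intro mult_left_mono m_mono) auto
        then have "real j * m (1 / 2 * r) \<le> 1 / s powr e'" using j by linarith
        then have "ln (real j * m (1 / 2 * r)) \<le> ln (1 / s powr e')"
          using pos j by (intro ln_mono) auto
        then have *: "ln (real j) + ln (m (1 / 2 * r)) \<le> e' * (- ln s)"
          using pos j s by (simp add: ln_mult ln_div ln_powr)
        have "ln r \<le> ln (2 * s)" "ln (r * 2) \<le> ln 1"
          using s elim by (auto intro!: ln_mono)
        then have "ln r \<le> ln 2 + ln s" "ln r + ln 2 \<le> 0"
          using s elim by (auto simp: ln_mult)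
        then have "- ln s \<le> 2 * ln (1 / r)" using elim by (simp add: ln_div)
        then have "e' * (- ln s) \<le> e' * (2 * ln (1 / r))" using e' by (intro mult_left_mono) auto
        also have "\<dots> = (2 * e') * ln (1 / r)" by simp
        also have "\<dots> \<le> e * ln (1 / r)" using e' elim by (intro mult_right_mono) auto
        finally have "ln (real j) \<le> e * ln (1 / r) - ln (m (1 / 2 * r))" using * by linarith
        then have "ereal (ln (real j)) \<le> ereal (e * ln (1 / r)) + I (1 / 2 * r)"
          using pos by (simp add: I_eq)
        then show ?thesis using Tj by (rule order_trans[rotated])
      qed
    qed
  qed
  \<comment> \<open>Positivity of the lower recurrence rate rules out the returns before \<open>r powr -a\<close>.\<close>
  obtain a where a: "0 < a" "ereal a < lower_recurrence_rate f x"
    using ereal_dense2[OF pos] by auto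
  have "eventually (\<lambda>r. ereal a < T r / ereal (ln (1 / r))) (at_right 0)"
    using a(2) unfolding rec by (rule less_LiminfD)
  then have T_gt: "eventually (\<lambda>r. ereal (a * ln (1 / r)) < T r) (at_right 0)"
    using eventually_ln_inverse_gt[of 0]
  proof eventually_elim
    case (elim r)
    then show ?case by (cases "T r") (auto simp: field_simps)
  qed
  have I_le_T: "eventually (\<lambda>r. I r \<le> ereal (e * ln (1 / r)) + T (1 / 8 * r)) (at_right 0)" if "0 < e" for e
  proof -
    obtain a' e' where a': "0 < a'" "a' \<le> a" and e': "0 < e'" "e' \<le> e / 2"
      and ev: "eventually (\<lambda>n. slow_return a' (((1 / 2) ^ n) powr e') ((1 / 2) ^ n) x) sequentially"
      using slow[of a "e / 2"] \<open>0 < e\<close> a(1) by auto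
    have "eventually (\<lambda>r. I (8 * r) \<le> ereal (e' * ln (1 / r)) + T r) (at_right 0)"
      using eventually_dyadic_neighbours[OF ev] eventually_at_right_0_less[OF zero_less_one] T_gt
    proof eventually_elim
      case (elim r)
      then obtain t where t: "r \<le> t" "t \<le> 2 * r" and st: "slow_return a' (t powr e') t x" by fastforce
      show ?case
      proof (cases rule: return_time_cases[of f r x])
        case infinite
        then show ?thesis by (simp only: T_def ln_ext_infinity) simp
      next
        case (finite k)
        then have Tk: "T r = ereal (ln (real k))"
          by (simp only: T_def ln_ext_of_nat)
        have "t powr - a' \<le> r powr - a'" using a' t elim by (intro powr_mono2') auto
        also have "\<dots> \<le> r powr - a" using a' elim by (intro powr_mono') auto
        also have "r powr - a = exp (a * ln (1 / r))" using elim by (simp add: powr_def ln_div)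
        also have "\<dots> < real k"
        proof -
          have "a * ln (1 / r) < ln (real k)" using elim Tk by simp
          then have "exp (a * ln (1 / r)) < exp (ln (real k))" by simp
          then show ?thesis using finite(2) by simp
        qed
        finally have "t powr e' < real k * m (4 * t)"
          using st finite t by (simp add: slow_return_def m_def)
        also have "\<dots> \<le> real k * m (8 * r)"
          using t by (intro mult_left_mono m_mono) auto
        finally have lt: "t powr e' < real k * m (8 * r)" .
        then have mpos: "0 < m (8 * r)"
          using finite(2) by (metis m_def measure_nonneg mult_zero_right not_less order_le_less powr_ge_zero)
        have tpos: "0 < t" using t elim by linarith
        have "ln (t powr e') \<le> ln (real k * m (8 * r))"
          using lt tpos by (intro ln_mono) auto
        then have "e' * ln t \<le> ln (real k) + ln (m (8 * r))"
          using mpos finite(2) tpos by (simp add: ln_mult ln_powr)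
        moreover have "e' * ln r \<le> e' * ln t"
          using e' t elim by (intro mult_left_mono) auto
        ultimately have "- ln (m (8 * r)) \<le> e' * ln (1 / r) + ln (real k)"
          using elim by (simp add: ln_div)
        then show ?thesis using mpos Tk by (simp add: I_eq)
      qed
    qed
    from eventually_at_right_0_scale[OF _ this, of "1 / 8"]
    have "eventually (\<lambda>r. I (8 * (1 / 8 * r)) \<le> ereal (e' * ln (1 / (1 / 8 * r))) + T (1 / 8 * r)) (at_right 0)"
      by simp
    moreover have "0 < (1 / 8 :: real)" by simp
    note eventually_at_right_0_less[OF this]
    ultimately show ?thesis
    proof eventually_elim
      case (elim r)
      have "ln (r * 8) \<le> ln 1" using elim by (intro ln_mono) auto
      then have "ln r + ln 8 \<le> 0" using elim by (simp add: ln_mult)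
      then have "ln (1 / (1 / 8 * r)) \<le> 2 * ln (1 / r)"
        using elim by (simp add: ln_div)
      then have "e' * ln (1 / (1 / 8 * r)) \<le> e' * (2 * ln (1 / r))"
        using e' by (intro mult_left_mono) auto
      also have "\<dots> = (2 * e') * ln (1 / r)" by simp
      also have "\<dots> \<le> e * ln (1 / r)" using e' elim by (intro mult_right_mono) auto
      finally have "ereal (e' * ln (1 / (1 / 8 * r))) + T (1 / 8 * r) \<le> ereal (e * ln (1 / r)) + T (1 / 8 * r)"
        by (intro add_right_mono) simp
      then show ?case using elim by simp
    qed
  qed
  have c: "0 < (1 / 2 :: real)" "0 < (1 / 8 :: real)" by simp_all
  note TI = log_ratio_le[OF c(1) always_eventually[OF allI[OF I0]] T_le_I]
    and IT = log_ratio_le[OF c(2) always_eventually[OF allI[OF T0]] I_le_T]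
  show "lower_recurrence_rate f x = lower_pointwise_dim M x"
    unfolding rec dim using TI(1) IT(1) by (rule order_antisym)
  show "upper_recurrence_rate f x = upper_pointwise_dim M x"
    unfolding rec dim using TI(2) IT(2) by (rule order_antisym)
qed

end

theorem theorem8:
  fixes \<mu> :: "'a::euclidean_space measure" and f :: "'a \<Rightarrow> 'a"
  assumes "prob_space \<mu>" and "sets \<mu> = sets borel"
    and "f \<in> measurable \<mu> \<mu>" and "distr \<mu> \<mu> f = \<mu>"
    and "superpolynomial_local_decay \<mu> f"
  shows "AE x in \<mu>. x \<in> {x. lower_recurrence_rate f x > 0} \<longrightarrow>
           lower_recurrence_rate f x = lower_pointwise_dim \<mu> x \<and>
           upper_recurrence_rate f x = upper_pointwise_dim \<mu> x"
proof -
  interpret prob_space \<mu> by fact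
  interpret measure_preserving_map \<mu> f
    by unfold_locales (fact assms)+
  obtain \<V> :: "'a set set" and \<theta> :: "'a set \<Rightarrow> nat \<Rightarrow> real" where
    "(\<forall>V\<in>\<V>. open V) \<and> disjoint \<V> \<and> (AE x in \<mu>. x \<in> \<Union>\<V>) \<and>
     (\<forall>V\<in>\<V>. \<forall>p>0. (\<lambda>n. real n powr p * \<theta> V n) \<longlonglongrightarrow> 0) \<and>
     (\<forall>V\<in>\<V>. correlation_bound V (\<theta> V))"
    using assms(5)[unfolded superpolynomial_local_decay_def, folded correlation_bound_def]
    by (elim exE) (rule that)
  then have op: "\<And>V. V \<in> \<V> \<Longrightarrow> open V" and disj: "disjoint \<V>" and full: "AE x in \<mu>. x \<in> \<Union>\<V>"
    and decay: "\<And>V p. V \<in> \<V> \<Longrightarrow> p > 0 \<Longrightarrow> (\<lambda>n. real n powr p * \<theta> V n) \<longlonglongrightarrow> 0"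
    and corr: "\<And>V. V \<in> \<V> \<Longrightarrow> correlation_bound V (\<theta> V)"
    by blast+
  have cnt: "countable \<V>"
    using op disj by (intro countable_disjoint_open_subsets) (auto simp: disjoint_def pairwise_def disjnt_def)
  define \<epsilon> where "\<epsilon> n = 1 / real (Suc n)" for n
  have \<epsilon>: "0 < \<epsilon> n" for n by (simp add: \<epsilon>_def)
  have \<epsilon>_le: "\<exists>n. \<epsilon> n \<le> e" if "0 < e" for e
    using reals_Archimedean[OF that] by (auto simp: \<epsilon>_def inverse_eq_divide intro: less_imp_le)
  have "AE x in \<mu>. \<forall>i. eventually (\<lambda>n. quick_return (((1 / 2) ^ n) powr (\<epsilon> i)) ((1 / 2) ^ n) x) sequentially"
    using AE_quick_return[OF \<epsilon>] by (simp only: AE_all_countable) blast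
  moreover have "AE x in \<mu>. \<forall>V\<in>\<V>. \<forall>i j. x \<in> V \<longrightarrow>
      eventually (\<lambda>n. slow_return (\<epsilon> i) (((1 / 2) ^ n) powr (\<epsilon> j)) ((1 / 2) ^ n) x) sequentially"
    using AE_slow_return[OF corr decay op \<epsilon> \<epsilon>]
    by (simp only: AE_all_countable AE_ball_countable[OF cnt]) blast
  ultimately show ?thesis
    using full
  proof eventually_elim
    case (elim x)
    show ?case
    proof
      assume "x \<in> {x. lower_recurrence_rate f x > 0}"
      then have pos: "0 < lower_recurrence_rate f x" by simp
      have quick: "\<exists>e'>0. e' \<le> e \<and> eventually (\<lambda>n. quick_return (((1 / 2) ^ n) powr e') ((1 / 2) ^ n) x) sequentially"
        if "0 < e" for e
        using \<epsilon>_le[OF that] \<epsilon> elim(1) by blast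
      have slow: "\<exists>a'>0. a' \<le> a \<and> (\<exists>e'>0. e' \<le> e \<and>
          eventually (\<lambda>n. slow_return a' (((1 / 2) ^ n) powr e') ((1 / 2) ^ n) x) sequentially)"
        if "0 < a" "0 < e" for a e
        using \<epsilon>_le[OF that(1)] \<epsilon>_le[OF that(2)] \<epsilon> elim(2,3) by blast
      show "lower_recurrence_rate f x = lower_pointwise_dim \<mu> x \<and>
          upper_recurrence_rate f x = upper_pointwise_dim \<mu> x"
        using recurrence_rates_eq_pointwise_dims[OF quick slow pos] by blast
    qed
  qed
qed

end
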